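(* Let $M$ be a complex manifold that is Kobayashi hyperbolic and taut, and let $f$ be a holomorphic vector field on $M$ generating a complete holomorphic flow $\phi_t:M\to M$, $t\ge0$, of $\dot z=f(z)$. Let $\Omega\subset M$ be forward invariant and suppose the system is intrinsically contracting with rate $\lambda>0$ on $\Omega$, i.e. for every $z\in\Omega$ and $v\in T_zM$, writing $z(t)=\phi_t(z)$ and $\delta z(t)=D\phi_t(z)v$, $$D^+F_K\big(z(t),\delta z(t)\big)\le-\lambda F_K\big(z(t),\delta z(t)\big)\qquad\text{for all }t\ge0 .$$ Then no nonconstant trajectory in $\Omega$ is periodic: if $z(t)=\phi_t(z(0))$ is a trajectory in $\Omega$ and $z(t+T)=z(t)$ for all $t\ge0$ and some $T>0$, then $z(t)$ is constant, equal to an equilibrium of $f$.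
   Context: Complex manifolds are connected, $TM$ is the holomorphic tangent bundle, $D=\{\zeta\in\mathbb{C}:|\zeta|<1\}$, and $\mathcal{O}(D,M)$ is the set of holomorphic maps $D\to M$. The Kobayashi infinitesimal pseudometric is $$F_K(z,v)=\inf\{\lambda>0:\exists\,h\in\mathcal{O}(D,M),\ h(0)=z,\ h'(0)=v/\lambda\},\quad z\in M,\ v\in T_zM,$$ and the Kobayashi pseudodistance is $d_K(x,y)=\inf_\gamma\int_0^1F_K(\gamma(s),\dot\gamma(s))\,ds$ over piecewise smooth curves joining $x$ to $y$. $M$ is Kobayashi hyperbolic if $d_K$ is a genuine distance; $M$ is taut if $\mathcal{O}(D,M)$ is a normal family (every sequence has a subsequence that either converges locally uniformly to an element of $\mathcal{O}(D,M)$ or is compactly divergent). On a taut Kobayashi hyperbolic manifold, $F_K$ is jointly continuous on $TM\setminus\{0\}$ and $F_K(z,v)>0$ for $v\ne0$. The upper Dini derivative of $\psi:\mathbb{R}_{\ge0}\to\mathbb{R}$ is $D^+\psi(t)=\limsup_{\epsilon\to0^+}(\psi(t+\epsilon)-\psi(t))/\epsilon$; $D^+F_K(z(t),\delta z(t))$ denotes the upper Dini derivative of $t\mapsto F_K(z(t),\delta z(t))$. A set $\Omega$ is forward invariant if $\phi_t(\Omega)\subset\Omega$ for all $t\ge0$; an equilibrium is a point $z^\star$ with $f(z^\star)=0$. *)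

theory Defs
  imports "HOL-Complex_Analysis.Complex_Analysis"
begin

definition holomorphic_vec_on :: "(complex^'n \<Rightarrow> complex^'m) \<Rightarrow> (complex^'n) set \<Rightarrow> bool"
  where "holomorphic_vec_on f S \<longleftrightarrow>
    (\<forall>x\<in>S. \<exists>f'. (f has_derivative f') (at x within S) \<and> (\<forall>a v. f' (a *s v) = a *s f' v))"

record ('a, 'n::finite) chart =
  chart_dom :: "'a set"
  coord :: "'a \<Rightarrow> complex^'n"

definition chart_inv :: "('a, 'n::finite) chart \<Rightarrow> complex^'n \<Rightarrow> 'a"
  where "chart_inv c = inv_into (chart_dom c) (coord c)"

definition complex_manifold :: "'a topology \<Rightarrow> ('a, 'n::finite) chart set \<Rightarrow> bool"
  where "complex_manifold M A \<longleftrightarrow>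
    Hausdorff_space M \<and> second_countable M \<and> connected_space M \<and>
    (\<Union>c\<in>A. chart_dom c) = topspace M \<and>
    (\<forall>c\<in>A. openin M (chart_dom c) \<and> open (coord c ` chart_dom c) \<and>
       homeomorphic_map (subtopology M (chart_dom c)) (top_of_set (coord c ` chart_dom c)) (coord c)) \<and>
    (\<forall>c\<in>A. \<forall>c'\<in>A.
       holomorphic_vec_on (coord c' \<circ> chart_inv c) (coord c ` (chart_dom c \<inter> chart_dom c')))"

text \<open>
  A (holomorphic) tangent vector at \<open>z\<close> is represented by the family of its coordinate vectors
  in all charts around \<open>z\<close>, subject to the usual transformation law; the family vanishes on all
  other charts, so that equality of tangent vectors is equality of functions, and the vector space
  operations are pointwise.
\<close>

type_synonym ('a, 'n) tangent_vector = "('a, 'n) chart \<Rightarrow> complex^'n"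

definition tangent_space ::
  "('a, 'n::finite) chart set \<Rightarrow> 'a \<Rightarrow> ('a, 'n) tangent_vector set"
  where "tangent_space A z =
    {v. (\<forall>c. \<not> (c \<in> A \<and> z \<in> chart_dom c) \<longrightarrow> v c = 0) \<and>
        (\<forall>c\<in>A. \<forall>c'\<in>A. z \<in> chart_dom c \<and> z \<in> chart_dom c' \<longrightarrow>
           v c' = frechet_derivative (coord c' \<circ> chart_inv c) (at (coord c z)) (v c))}"

definition holomorphic_self_map :: "'a topology \<Rightarrow> ('a, 'n::finite) chart set \<Rightarrow> ('a \<Rightarrow> 'a) \<Rightarrow> bool"
  where "holomorphic_self_map M A F \<longleftrightarrow>
    continuous_map M M F \<and>
    (\<forall>c\<in>A. \<forall>c'\<in>A. holomorphic_vec_on (coord c' \<circ> F \<circ> chart_inv c)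
        (coord c ` {z \<in> chart_dom c. F z \<in> chart_dom c'}))"

text \<open>
  The differential of \<open>F\<close> at \<open>z\<close>, computed from some chart around \<open>z\<close>; for \<open>v\<close> in the tangent space
  at \<open>z\<close> the result does not depend on that chart.
\<close>

definition tangent_map ::
  "('a, 'n::finite) chart set \<Rightarrow> ('a \<Rightarrow> 'a) \<Rightarrow> 'a \<Rightarrow> ('a, 'n) tangent_vector \<Rightarrow> ('a, 'n) tangent_vector"
  where "tangent_map A F z v =
    (let c = (SOME c. c \<in> A \<and> z \<in> chart_dom c) in
     (\<lambda>c'. if c' \<in> A \<and> F z \<in> chart_dom c'
           then frechet_derivative (coord c' \<circ> F \<circ> chart_inv c) (at (coord c z)) (v c)
           else 0))"

definition holomorphic_vector_field ::
  "'a topology \<Rightarrow> ('a, 'n::finite) chart set \<Rightarrow> ('a \<Rightarrow> ('a, 'n) tangent_vector) \<Rightarrow> bool"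
  where "holomorphic_vector_field M A f \<longleftrightarrow>
    (\<forall>z\<in>topspace M. f z \<in> tangent_space A z) \<and>
    (\<forall>c\<in>A. holomorphic_vec_on (\<lambda>x. f (chart_inv c x) c) (coord c ` chart_dom c))"

definition holomorphic_discs :: "'a topology \<Rightarrow> ('a, 'n::finite) chart set \<Rightarrow> (complex \<Rightarrow> 'a) set"
  where "holomorphic_discs M A =
    {h. continuous_map (top_of_set (ball 0 1)) M h \<and>
        (\<forall>c\<in>A. \<forall>i. (\<lambda>\<zeta>. coord c (h \<zeta>) $ i) holomorphic_on {\<zeta> \<in> ball 0 1. h \<zeta> \<in> chart_dom c})}"

definition disc_deriv0 ::
  "('a, 'n::finite) chart set \<Rightarrow> (complex \<Rightarrow> 'a) \<Rightarrow> ('a, 'n) tangent_vector"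
  where "disc_deriv0 A h =
    (\<lambda>c. if c \<in> A \<and> h 0 \<in> chart_dom c then (\<chi> i. deriv (\<lambda>\<zeta>. coord c (h \<zeta>) $ i) 0) else 0)"

definition kobayashi_metric ::
  "'a topology \<Rightarrow> ('a, 'n::finite) chart set \<Rightarrow> 'a \<Rightarrow> ('a, 'n) tangent_vector \<Rightarrow> real"
  where "kobayashi_metric M A z v =
    Inf {l. l > 0 \<and> (\<exists>h\<in>holomorphic_discs M A. h 0 = z \<and> disc_deriv0 A h = (\<lambda>c. v c /\<^sub>R l))}"

text \<open>\<open>g k\<close> is the \<open>k\<close>-th derivative in the chart, one-sided at the end points of the interval.\<close>

definition smooth_curve_on ::
  "'a topology \<Rightarrow> ('a, 'n::finite) chart set \<Rightarrow> real \<Rightarrow> real \<Rightarrow> (real \<Rightarrow> 'a) \<Rightarrow> bool"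
  where "smooth_curve_on M A a b \<gamma> \<longleftrightarrow>
    continuous_map (top_of_set {a..b}) M \<gamma> \<and>
    (\<forall>c\<in>A. let J = {t \<in> {a..b}. \<gamma> t \<in> chart_dom c} in
       \<exists>g :: nat \<Rightarrow> real \<Rightarrow> complex^'n.
         (\<forall>t\<in>J. g 0 t = coord c (\<gamma> t)) \<and>
         (\<forall>k. \<forall>t\<in>J. (g k has_vector_derivative g (Suc k) t) (at t within J)))"

definition piecewise_smooth_curve ::
  "'a topology \<Rightarrow> ('a, 'n::finite) chart set \<Rightarrow> (real \<Rightarrow> 'a) \<Rightarrow> bool"
  where "piecewise_smooth_curve M A \<gamma> \<longleftrightarrow>
    continuous_map (top_of_set {0..1}) M \<gamma> \<and>
    (\<exists>S. finite S \<and> (\<forall>a b. 0 \<le> a \<and> a < b \<and> b \<le> 1 \<and> {a<..<b} \<inter> S = {} \<longrightarrow>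
       smooth_curve_on M A a b \<gamma>))"

definition velocity ::
  "('a, 'n::finite) chart set \<Rightarrow> (real \<Rightarrow> 'a) \<Rightarrow> real \<Rightarrow> ('a, 'n) tangent_vector"
  where "velocity A \<gamma> s =
    (\<lambda>c. if c \<in> A \<and> \<gamma> s \<in> chart_dom c then vector_derivative (\<lambda>t. coord c (\<gamma> t)) (at s) else 0)"

text \<open>
  The velocity is meaningful off the finite set of break points, which does not affect the integral.
\<close>

definition kobayashi_length ::
  "'a topology \<Rightarrow> ('a, 'n::finite) chart set \<Rightarrow> (real \<Rightarrow> 'a) \<Rightarrow> ennreal"
  where "kobayashi_length M A \<gamma> =
    (\<integral>\<^sup>+ s \<in> {0..1}. ennreal (kobayashi_metric M A (\<gamma> s) (velocity A \<gamma> s)) \<partial>lborel)"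

text \<open>
  The infimum is finite, since a complex manifold is connected and its Kobayashi pseudometric is
  locally bounded.
\<close>

definition kobayashi_dist :: "'a topology \<Rightarrow> ('a, 'n::finite) chart set \<Rightarrow> 'a \<Rightarrow> 'a \<Rightarrow> real"
  where "kobayashi_dist M A x y =
    enn2real (INF \<gamma> \<in> {\<gamma>. piecewise_smooth_curve M A \<gamma> \<and> \<gamma> 0 = x \<and> \<gamma> 1 = y}.
      kobayashi_length M A \<gamma>)"

definition kobayashi_hyperbolic :: "'a topology \<Rightarrow> ('a, 'n::finite) chart set \<Rightarrow> bool"
  where "kobayashi_hyperbolic M A \<longleftrightarrow> Metric_space (topspace M) (kobayashi_dist M A)"

text \<open>
  As \<open>M\<close> carries no distinguished metric, locally uniform convergence on the unit disc is convergence
  in the compact-open topology; for any metric inducing the topology of \<open>M\<close> and a continuous limit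
  this is uniform convergence on compact sets.
\<close>

definition locally_uniform_limit ::
  "'a topology \<Rightarrow> (nat \<Rightarrow> complex \<Rightarrow> 'a) \<Rightarrow> (complex \<Rightarrow> 'a) \<Rightarrow> bool"
  where "locally_uniform_limit M h g \<longleftrightarrow>
    (\<forall>K U. compact K \<and> K \<subseteq> ball 0 1 \<and> openin M U \<and> g ` K \<subseteq> U \<longrightarrow>
      (\<forall>\<^sub>F n in sequentially. h n ` K \<subseteq> U))"

definition compactly_divergent :: "'a topology \<Rightarrow> (nat \<Rightarrow> complex \<Rightarrow> 'a) \<Rightarrow> bool"
  where "compactly_divergent M h \<longleftrightarrow>
    (\<forall>K L. compact K \<and> K \<subseteq> ball 0 1 \<and> compactin M L \<longrightarrow>
      (\<forall>\<^sub>F n in sequentially. h n ` K \<inter> L = {}))"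

definition taut :: "'a topology \<Rightarrow> ('a, 'n::finite) chart set \<Rightarrow> bool"
  where "taut M A \<longleftrightarrow>
    (\<forall>h. (\<forall>n. h n \<in> holomorphic_discs M A) \<longrightarrow>
      (\<exists>r::nat\<Rightarrow>nat. strict_mono r \<and>
        ((\<exists>g\<in>holomorphic_discs M A. locally_uniform_limit M (h \<circ> r) g) \<or>
         compactly_divergent M (h \<circ> r))))"

text \<open>
  Continuity is required separately because \<open>coord c\<close> carries no information outside the domain
  of \<open>c\<close>.
\<close>

definition integral_curve ::
  "'a topology \<Rightarrow> ('a, 'n::finite) chart set \<Rightarrow> ('a \<Rightarrow> ('a, 'n) tangent_vector) \<Rightarrow> (real \<Rightarrow> 'a) \<Rightarrow> bool"
  where "integral_curve M A f \<gamma> \<longleftrightarrow>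
    continuous_map (top_of_set {0..}) M \<gamma> \<and>
    (\<forall>t\<ge>0. \<forall>c\<in>A. \<gamma> t \<in> chart_dom c \<longrightarrow>
      ((\<lambda>s. coord c (\<gamma> s)) has_vector_derivative f (\<gamma> t) c) (at t within {0..}))"

definition complete_holomorphic_flow ::
  "'a topology \<Rightarrow> ('a, 'n::finite) chart set \<Rightarrow> ('a \<Rightarrow> ('a, 'n) tangent_vector) \<Rightarrow>
    (real \<Rightarrow> 'a \<Rightarrow> 'a) \<Rightarrow> bool"
  where "complete_holomorphic_flow M A f \<phi> \<longleftrightarrow>
    (\<forall>t\<ge>0. holomorphic_self_map M A (\<phi> t)) \<and>
    (\<forall>z\<in>topspace M. \<phi> 0 z = z) \<and>
    (\<forall>s\<ge>0. \<forall>t\<ge>0. \<forall>z\<in>topspace M. \<phi> (s + t) z = \<phi> s (\<phi> t z)) \<and>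
    (\<forall>z\<in>topspace M. integral_curve M A f (\<lambda>t. \<phi> t z))"

definition forward_invariant :: "(real \<Rightarrow> 'a \<Rightarrow> 'a) \<Rightarrow> 'a set \<Rightarrow> bool"
  where "forward_invariant \<phi> \<Omega> \<longleftrightarrow> (\<forall>t\<ge>0. \<phi> t ` \<Omega> \<subseteq> \<Omega>)"

definition upper_dini_deriv :: "(real \<Rightarrow> real) \<Rightarrow> real \<Rightarrow> ereal"
  where "upper_dini_deriv \<psi> t =
    Limsup (at_right 0) (\<lambda>\<epsilon>. ereal ((\<psi> (t + \<epsilon>) - \<psi> t) / \<epsilon>))"

definition intrinsically_contracting ::
  "'a topology \<Rightarrow> ('a, 'n::finite) chart set \<Rightarrow> (real \<Rightarrow> 'a \<Rightarrow> 'a) \<Rightarrow> real \<Rightarrow> 'a set \<Rightarrow> bool"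
  where "intrinsically_contracting M A \<phi> rate \<Omega> \<longleftrightarrow>
    (\<forall>z\<in>\<Omega>. \<forall>v\<in>tangent_space A z.
      let \<psi> = (\<lambda>t. kobayashi_metric M A (\<phi> t z) (tangent_map A (\<phi> t) z v))
      in \<forall>t\<ge>0. upper_dini_deriv \<psi> t \<le> ereal (- rate * \<psi> t))"

end

theory Submission
  imports Defs
begin

text \<open>
  Along a trajectory \<open>z\<close> put \<open>\<psi> t = F\<^sub>K (z t, f (z t))\<close>. The flow carries the vector field to itself,
  \<open>D\<phi>\<^sub>s (f (z t)) = f (z (s + t))\<close> (\<open>tangent_map_flow\<close>), so \<open>\<psi>\<close> is the function whose upper Dini
  derivative the contraction hypothesis bounds when the initial tangent vector is \<open>f (z 0)\<close>.

  The key point is that \<open>\<psi>\<close> is nonincreasing for a reason independent of the rate: each \<open>\<phi>\<^sub>s\<close> is a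
  holomorphic self-map, and holomorphic maps do not increase \<open>F\<^sub>K\<close>
  (\<open>kobayashi_metric_tangent_map_le\<close>), because composing with the map sends competing discs to
  competing discs. On a periodic trajectory \<open>\<psi>\<close> is also periodic, hence constant, so its Dini
  derivative is zero. Contraction then says \<open>0 \<le> - rate * \<psi> 0\<close>, and as \<open>F\<^sub>K \<ge> 0\<close> this forces
  \<open>\<psi> = 0\<close>.

  On a taut manifold \<open>F\<^sub>K\<close> vanishes only on zero vectors (\<open>taut_kobayashi_metric_eq_0\<close>): discs
  through one point with derivatives tending to infinity would have a locally uniformly convergent
  subsequence, against the Cauchy estimate. So \<open>f\<close> vanishes along the trajectory, the velocity of
  the trajectory is zero in every chart, and the trajectory is constant
  (\<open>integral_curve_constant\<close>).
\<close>

section \<open>Holomorphic maps between coordinate spaces\<close>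

lemma holomorphic_vec_on_frechet:
  assumes "holomorphic_vec_on G S" "open S" "x \<in> S"
  shows "(G has_derivative frechet_derivative G (at x)) (at x)"
    and "frechet_derivative G (at x) (a *s v) = a *s frechet_derivative G (at x) v"
proof -
  obtain G' where G': "(G has_derivative G') (at x within S)" "\<And>a v. G' (a *s v) = a *s G' v"
    using assms unfolding holomorphic_vec_on_def by blast
  then have "(G has_derivative G') (at x)"
    using assms at_within_open by metis
  moreover from this have "frechet_derivative G (at x) = G'"
    using frechet_derivative_at by metis
  ultimately show "(G has_derivative frechet_derivative G (at x)) (at x)"
    and "frechet_derivative G (at x) (a *s v) = a *s frechet_derivative G (at x) v"
    using G'(2) by auto
qed

text \<open>
  The left side is convenient for the chain rule with maps between charts, the right side is the form
  in which holomorphic discs are given.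
\<close>

lemma has_derivative_complex_line_iff:
  fixes g :: "complex \<Rightarrow> complex^'n::finite"
  shows "(g has_derivative (\<lambda>x. x *s d)) (at \<zeta>) \<longleftrightarrow>
    (\<forall>i. ((\<lambda>\<zeta>. g \<zeta> $ i) has_field_derivative d $ i) (at \<zeta>))"
proof
  assume L: "(g has_derivative (\<lambda>x. x *s d)) (at \<zeta>)"
  have "((\<lambda>\<zeta>. g \<zeta> $ i) has_derivative (\<lambda>x. (x *s d) $ i)) (at \<zeta>)" for i
    using bounded_linear.has_derivative[OF bounded_linear_vec_nth L] .
  then show "\<forall>i. ((\<lambda>\<zeta>. g \<zeta> $ i) has_field_derivative d $ i) (at \<zeta>)"
    unfolding has_field_derivative_def vector_smult_component by (subst (asm) mult.commute) blast
next
  assume R: "\<forall>i. ((\<lambda>\<zeta>. g \<zeta> $ i) has_field_derivative d $ i) (at \<zeta>)"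
  have "((\<lambda>x. g x \<bullet> b) has_derivative (\<lambda>x. (x *s d) \<bullet> b)) (at \<zeta>)" if "b \<in> Basis" for b
  proof -
    obtain i u where b: "b = axis i u" using \<open>b \<in> Basis\<close> unfolding Basis_vec_def by blast
    have "((\<lambda>x. g x $ i) has_derivative (\<lambda>x. d $ i * x)) (at \<zeta>)"
      using R by (simp add: has_field_derivative_def)
    then have "((\<lambda>x. g x $ i \<bullet> u) has_derivative (\<lambda>x. (d $ i * x) \<bullet> u)) (at \<zeta>)"
      by (rule has_derivative_inner_left)
    then show ?thesis by (simp add: b inner_axis mult.commute)
  qed
  then show "(g has_derivative (\<lambda>x. x *s d)) (at \<zeta>)"
    by (subst has_derivative_componentwise_within) blast
qed

lemma holomorphic_vec_on_chain:
  assumes "holomorphic_vec_on G S" "open S" "g \<zeta> \<in> S"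
    and g: "(g has_derivative (\<lambda>x. x *s d)) (at \<zeta>)"
    and k: "\<forall>\<^sub>F w in nhds \<zeta>. k w = G (g w)"
  shows "(k has_derivative (\<lambda>x. x *s frechet_derivative G (at (g \<zeta>)) d)) (at \<zeta>)"
proof -
  note G = holomorphic_vec_on_frechet[OF assms(1-3)]
  have "((\<lambda>w. G (g w)) has_derivative (\<lambda>x. x *s frechet_derivative G (at (g \<zeta>)) d)) (at \<zeta>)"
    using has_derivative_compose[OF g G(1)] by (simp add: G(2))
  moreover have "\<forall>\<^sub>F w in at \<zeta>. G (g w) = k w" "G (g \<zeta>) = k \<zeta>"
    using k by (auto simp: eventually_nhds_conv_at elim: eventually_mono)
  ultimately show ?thesis
    by (rule has_derivative_transform_eventually) auto
qed

section \<open>Charts and holomorphic discs\<close>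

context
  fixes M :: "'a topology" and A :: "('a, 'n::finite) chart set"
  assumes manifold: "complex_manifold M A"
begin

lemma chart_around:
  assumes "z \<in> topspace M"
  obtains c where "c \<in> A" "z \<in> chart_dom c"
  using assms manifold unfolding complex_manifold_def by blast

lemma openin_chart_dom: "c \<in> A \<Longrightarrow> openin M (chart_dom c)"
  using manifold unfolding complex_manifold_def by blast

lemma homeomorphic_map_coord:
  "c \<in> A \<Longrightarrow>
    homeomorphic_map (subtopology M (chart_dom c)) (top_of_set (coord c ` chart_dom c)) (coord c)"
  using manifold unfolding complex_manifold_def by blast

lemma topspace_chart: "c \<in> A \<Longrightarrow> topspace (subtopology M (chart_dom c)) = chart_dom c"
  using openin_subset[OF openin_chart_dom] by (simp add: Int_absorb1)

lemma chart_inv_coord: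
  assumes "c \<in> A" "z \<in> chart_dom c"
  shows "chart_inv c (coord c z) = z"
  using assms homeomorphic_imp_injective_map[OF homeomorphic_map_coord[OF assms(1)]]
  unfolding chart_inv_def topspace_chart[OF assms(1)] by (simp add: inv_into_f_f)

lemma chart_inv_in:
  "x \<in> coord c ` chart_dom c \<Longrightarrow> chart_inv c x \<in> chart_dom c"
  by (simp add: chart_inv_def inv_into_into)

lemma coord_chart_inv:
  "x \<in> coord c ` chart_dom c \<Longrightarrow> coord c (chart_inv c x) = x"
  by (simp add: chart_inv_def f_inv_into_f)

lemma open_coord_image:
  assumes "c \<in> A" "openin M V"
  shows "open (coord c ` (chart_dom c \<inter> V))"
proof -
  have "openin (subtopology M (chart_dom c)) (chart_dom c \<inter> V)"
    using assms by (auto simp: openin_subtopology)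
  then have "openin (top_of_set (coord c ` chart_dom c)) (coord c ` (chart_dom c \<inter> V))"
    using homeomorphic_imp_open_map[OF homeomorphic_map_coord[OF assms(1)]]
    by (simp add: open_map_def)
  moreover have "open (coord c ` chart_dom c)"
    using manifold assms unfolding complex_manifold_def by blast
  ultimately show ?thesis
    using openin_open_trans by blast
qed

lemma continuous_map_chart_inv:
  assumes "c \<in> A"
  shows "continuous_map (top_of_set (coord c ` chart_dom c)) M (chart_inv c)"
proof -
  obtain g where g: "homeomorphic_maps (subtopology M (chart_dom c))
      (top_of_set (coord c ` chart_dom c)) (coord c) g"
    using homeomorphic_map_coord[OF assms] homeomorphic_map_maps by blast
  then have "continuous_map (top_of_set (coord c ` chart_dom c)) M g"
    unfolding homeomorphic_maps_def by (auto intro: continuous_map_into_fulltopology)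
  moreover have "g x = chart_inv c x" if "x \<in> topspace (top_of_set (coord c ` chart_dom c))" for x
    using g that chart_inv_coord[OF assms] unfolding homeomorphic_maps_def topspace_chart[OF assms]
    by auto
  ultimately show ?thesis
    by (rule continuous_map_eq)
qed

lemma openin_coord_preimage:
  assumes "c \<in> A" "open V"
  shows "openin M {z \<in> chart_dom c. coord c z \<in> V}"
proof -
  have "continuous_map (subtopology M (chart_dom c)) euclidean (coord c)"
    using homeomorphic_imp_continuous_map[OF homeomorphic_map_coord[OF assms(1)]]
      continuous_map_into_fulltopology by blast
  then have "openin (subtopology M (chart_dom c)) {z \<in> chart_dom c. coord c z \<in> V}"
    using openin_continuous_map_preimage[of _ _ _ V] assms(2) topspace_chart[OF assms(1)] by fastforce
  then show ?thesis
    using openin_chart_dom[OF assms(1)] openin_trans_full by blast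
qed

lemma open_self_map_chart_domain:
  assumes "continuous_map M M F" "c \<in> A" "c' \<in> A"
  shows "open (coord c ` {z \<in> chart_dom c. F z \<in> chart_dom c'})"
proof -
  have "chart_dom c \<inter> {z \<in> topspace M. F z \<in> chart_dom c'} = {z \<in> chart_dom c. F z \<in> chart_dom c'}"
    using openin_subset[OF openin_chart_dom[OF assms(2)]] by blast
  then show ?thesis
    using open_coord_image[OF assms(2)
        openin_continuous_map_preimage[OF assms(1) openin_chart_dom[OF assms(3)]]]
    by simp
qed

text \<open>
  The chart obtained here is the arbitrarily selected one in the definition of the differential.
\<close>

lemma tangent_map_in_chart:
  assumes "z \<in> topspace M"
  obtains c where "c \<in> A" "z \<in> chart_dom c"
    and "\<And>F v c'. tangent_map A F z v c' =
      (if c' \<in> A \<and> F z \<in> chart_dom c'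
       then frechet_derivative (coord c' \<circ> F \<circ> chart_inv c) (at (coord c z)) (v c) else 0)"
proof
  define c where "c = (SOME c. c \<in> A \<and> z \<in> chart_dom c)"
  show "c \<in> A" "z \<in> chart_dom c"
    using someI_ex[of "\<lambda>c. c \<in> A \<and> z \<in> chart_dom c"] chart_around[OF assms] unfolding c_def by blast+
  show "tangent_map A F z v c' =
      (if c' \<in> A \<and> F z \<in> chart_dom c'
       then frechet_derivative (coord c' \<circ> F \<circ> chart_inv c) (at (coord c z)) (v c) else 0)" for F v c'
    by (simp add: tangent_map_def Let_def c_def)
qed

lemma tangent_vector_transition:
  assumes "v \<in> tangent_space A z" "c \<in> A" "c' \<in> A" "z \<in> chart_dom c" "z \<in> chart_dom c'"
  shows "v c' = frechet_derivative (coord c' \<circ> chart_inv c) (at (coord c z)) (v c)"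
  using assms unfolding tangent_space_def by blast

lemma open_disc_preimage:
  assumes "continuous_map (top_of_set (ball 0 1)) M (h :: complex \<Rightarrow> 'a)" "openin M U"
  shows "open {\<zeta> \<in> ball 0 1. h \<zeta> \<in> U}"
  using openin_continuous_map_preimage[OF assms] openin_open_trans[OF _ open_ball] by fastforce

lemma holomorphic_disc_deriv:
  assumes "h \<in> holomorphic_discs M A" "c \<in> A" "\<zeta> \<in> ball 0 1" "h \<zeta> \<in> chart_dom c"
  shows "((\<lambda>\<zeta>. coord c (h \<zeta>)) has_derivative
    (\<lambda>x. x *s (\<chi> i. deriv (\<lambda>\<zeta>. coord c (h \<zeta>) $ i) \<zeta>))) (at \<zeta>)"
proof -
  have "open {\<zeta> \<in> ball 0 1. h \<zeta> \<in> chart_dom c}"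
    using open_disc_preimage openin_chart_dom assms unfolding holomorphic_discs_def by blast
  moreover have "(\<lambda>\<zeta>. coord c (h \<zeta>) $ i) holomorphic_on {\<zeta> \<in> ball 0 1. h \<zeta> \<in> chart_dom c}" for i
    using assms unfolding holomorphic_discs_def by blast
  ultimately have "((\<lambda>\<zeta>. coord c (h \<zeta>) $ i) has_field_derivative
      deriv (\<lambda>\<zeta>. coord c (h \<zeta>) $ i) \<zeta>) (at \<zeta>)" for i
    using holomorphic_derivI assms by blast
  then show ?thesis by (simp add: has_derivative_complex_line_iff)
qed

lemma holomorphic_discI:
  assumes cont: "continuous_map (top_of_set (ball 0 1)) M h"
    and deriv: "\<And>c \<zeta>. c \<in> A \<Longrightarrow> \<zeta> \<in> ball 0 1 \<Longrightarrow> h \<zeta> \<in> chart_dom c \<Longrightarrow>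
      \<exists>d. ((\<lambda>\<zeta>. coord c (h \<zeta>)) has_derivative (\<lambda>x. x *s d)) (at \<zeta>)"
  shows "h \<in> holomorphic_discs M A"
  unfolding holomorphic_discs_def
proof (intro CollectI conjI ballI allI)
  fix c i assume "c \<in> A"
  have "(\<lambda>\<zeta>. coord c (h \<zeta>) $ i) field_differentiable at \<zeta>"
    if "\<zeta> \<in> ball 0 1" "h \<zeta> \<in> chart_dom c" for \<zeta>
    using deriv[OF \<open>c \<in> A\<close> that]
    unfolding has_derivative_complex_line_iff field_differentiable_def by blast
  then show "(\<lambda>\<zeta>. coord c (h \<zeta>) $ i) holomorphic_on {\<zeta> \<in> ball 0 1. h \<zeta> \<in> chart_dom c}"
    by (auto simp: holomorphic_on_def intro: field_differentiable_at_within)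
qed (rule cont)

lemma disc_deriv0_eqI:
  assumes "\<And>c. c \<in> A \<Longrightarrow> h 0 \<in> chart_dom c \<Longrightarrow>
      ((\<lambda>\<zeta>. coord c (h \<zeta>)) has_derivative (\<lambda>x. x *s w c)) (at 0)"
    and "\<And>c. \<not> (c \<in> A \<and> h 0 \<in> chart_dom c) \<Longrightarrow> w c = 0"
  shows "disc_deriv0 A h = w"
proof
  fix c
  show "disc_deriv0 A h c = w c"
  proof (cases "c \<in> A \<and> h 0 \<in> chart_dom c")
    case True
    then have "deriv (\<lambda>\<zeta>. coord c (h \<zeta>) $ i) 0 = w c $ i" for i
      using assms(1)[of c] unfolding has_derivative_complex_line_iff by (blast intro: DERIV_imp_deriv)
    then show ?thesis using True by (simp add: disc_deriv0_def vec_eq_iff)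
  qed (use assms(2) in \<open>auto simp: disc_deriv0_def\<close>)
qed

lemma eventually_disc_in:
  fixes h :: "complex \<Rightarrow> 'a"
  assumes "continuous_map (top_of_set (ball 0 1)) M h" "openin M U" "\<zeta> \<in> ball 0 1" "h \<zeta> \<in> U"
  shows "\<forall>\<^sub>F w in nhds \<zeta>. w \<in> ball 0 1 \<and> h w \<in> U"
  using eventually_nhds_in_open[OF open_disc_preimage[OF assms(1,2)], of \<zeta>] assms(3,4) by simp

section \<open>Properties of the Kobayashi metric\<close>

abbreviation disc_scales :: "'a \<Rightarrow> ('a, 'n) tangent_vector \<Rightarrow> real set"
  where "disc_scales z v \<equiv>
    {l. l > 0 \<and> (\<exists>h\<in>holomorphic_discs M A. h 0 = z \<and> disc_deriv0 A h = (\<lambda>c. v c /\<^sub>R l))}"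

lemma bdd_below_disc_scales: "bdd_below (disc_scales z v)"
  by (rule bdd_belowI[of _ 0]) auto

text \<open>
  Through every tangent vector there is a small disc that is affine in a chart. This matters because
  the infimum of the empty set of reals is an unspecified number.
\<close>

lemma disc_scales_nonempty:
  assumes z: "z \<in> topspace M" and v: "v \<in> tangent_space A z"
  shows "disc_scales z v \<noteq> {}"
proof -
  obtain c where c: "c \<in> A" "z \<in> chart_dom c" using z chart_around by blast
  define E where "E = coord c ` chart_dom c"
  have E: "open E" using open_coord_image[OF c(1) openin_chart_dom[OF c(1)]] by (simp add: E_def)
  have "coord c z \<in> E" using c by (simp add: E_def)
  then obtain r where r: "r > 0" "ball (coord c z) r \<subseteq> E" using E openE by blast
  \<comment> \<open>The scaling that keeps the affine disc inside the chart; the summand 1 covers \<open>v c = 0\<close>.\<close>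
  define e where "e = r / (norm (v c) + 1)"
  have np: "norm (v c) + 1 > 0" using norm_ge_zero[of "v c"] by linarith
  have e: "e > 0" "e * norm (v c) < r"
    using r(1) np unfolding e_def by (auto simp: field_simps)
  define g where "g \<zeta> = coord c z + \<zeta> *s (e *\<^sub>R v c)" for \<zeta>
  define h where "h \<zeta> = chart_inv c (g \<zeta>)" for \<zeta>
  have g0: "g 0 = coord c z" and h0: "h 0 = z"
    using chart_inv_coord c by (simp_all add: g_def h_def)
  have nsm: "norm (\<zeta> *s w) = norm \<zeta> * norm w" for \<zeta> and w :: "complex^'n"
    by (simp add: norm_vec_def L2_set_right_distrib norm_mult)
  have gE: "g \<zeta> \<in> E" if "\<zeta> \<in> ball 0 1" for \<zeta>
  proof -
    have "norm (\<zeta> *s (e *\<^sub>R v c)) = norm \<zeta> * (e * norm (v c))" using e by (simp add: nsm)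
    also have "\<dots> \<le> e * norm (v c)" using that e by (simp add: mult_left_le_one_le)
    finally show ?thesis using e(2) r(2) by (auto simp: g_def dist_norm)
  qed
  have g': "(g has_derivative (\<lambda>x. x *s (e *\<^sub>R v c))) (at \<zeta>)" for \<zeta>
    unfolding has_derivative_complex_line_iff g_def by (auto intro!: derivative_eq_intros)
  have cont: "continuous_map (top_of_set (ball 0 1)) M h"
  proof -
    have "continuous_on (ball 0 1) g"
      by (intro continuous_at_imp_continuous_on ballI has_derivative_continuous[OF g'])
    then have "continuous_map (top_of_set (ball 0 1)) (top_of_set E) g"
      using gE by (auto simp: image_subset_iff)
    from continuous_map_compose[OF this continuous_map_chart_inv[OF c(1), folded E_def]]
    show ?thesis by (simp add: h_def[abs_def] o_def)
  qed
  have h': "((\<lambda>\<zeta>. coord c' (h \<zeta>)) has_derivative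
      (\<lambda>x. x *s frechet_derivative (coord c' \<circ> chart_inv c) (at (g \<zeta>)) (e *\<^sub>R v c))) (at \<zeta>)"
    if "c' \<in> A" "\<zeta> \<in> ball 0 1" "h \<zeta> \<in> chart_dom c'" for c' \<zeta>
  proof (rule holomorphic_vec_on_chain[where S = "coord c ` (chart_dom c \<inter> chart_dom c')", OF _ _ _ g'])
    show "holomorphic_vec_on (coord c' \<circ> chart_inv c) (coord c ` (chart_dom c \<inter> chart_dom c'))"
      using manifold c that unfolding complex_manifold_def by blast
    show "open (coord c ` (chart_dom c \<inter> chart_dom c'))"
      using open_coord_image c openin_chart_dom that by blast
    have gE': "g \<zeta> \<in> coord c ` chart_dom c" using gE that E_def by blast
    have "g \<zeta> = coord c (h \<zeta>)" "h \<zeta> \<in> chart_dom c"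
      unfolding h_def using coord_chart_inv[OF gE'] chart_inv_in[OF gE'] by auto
    then show "g \<zeta> \<in> coord c ` (chart_dom c \<inter> chart_dom c')" using that(3) by blast
  qed (simp add: h_def)
  have disc: "h \<in> holomorphic_discs M A"
    using cont h' by (intro holomorphic_discI) blast+
  have tr: "frechet_derivative (coord c' \<circ> chart_inv c) (at (coord c z)) (e *\<^sub>R v c) = e *\<^sub>R v c'"
    if "c' \<in> A" "z \<in> chart_dom c'" for c'
  proof -
    have hv: "holomorphic_vec_on (coord c' \<circ> chart_inv c) (coord c ` (chart_dom c \<inter> chart_dom c'))"
      using manifold c that unfolding complex_manifold_def by blast
    have op: "open (coord c ` (chart_dom c \<inter> chart_dom c'))"
      using open_coord_image c openin_chart_dom that by blast
    have "linear (frechet_derivative (coord c' \<circ> chart_inv c) (at (coord c z)))"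
      using holomorphic_vec_on_frechet(1)[OF hv op] c that has_derivative_linear by blast
    then show ?thesis
      using tangent_vector_transition[OF v c(1) that(1) c(2) that(2)] by (simp add: linear_scale)
  qed
  have "disc_deriv0 A h = (\<lambda>c'. e *\<^sub>R v c')"
  proof (rule disc_deriv0_eqI)
    show "((\<lambda>\<zeta>. coord c' (h \<zeta>)) has_derivative (\<lambda>x. x *s (e *\<^sub>R v c'))) (at 0)"
      if "c' \<in> A" "h 0 \<in> chart_dom c'" for c'
      using h'[OF that(1) _ that(2)] tr[OF that(1)] that(2) by (simp add: g0 h0)
    show "e *\<^sub>R v c' = 0" if "\<not> (c' \<in> A \<and> h 0 \<in> chart_dom c')" for c'
      using v that unfolding tangent_space_def by (auto simp: h0)
  qed
  then have "1 / e \<in> disc_scales z v" using disc h0 e by auto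
  then show ?thesis by blast
qed

lemma kobayashi_metric_nonneg:
  assumes "z \<in> topspace M" "v \<in> tangent_space A z"
  shows "kobayashi_metric M A z v \<ge> 0"
  unfolding kobayashi_metric_def using disc_scales_nonempty[OF assms] by (intro cInf_greatest) auto

text \<open>
  Composition with a holomorphic self-map turns a disc through \<open>v\<close> into a disc of the same scale
  through the image of \<open>v\<close>, so the infimum for the image is over a larger set.
\<close>

lemma kobayashi_metric_tangent_map_le:
  assumes F: "holomorphic_self_map M A F" and z: "z \<in> topspace M" and v: "v \<in> tangent_space A z"
  shows "kobayashi_metric M A (F z) (tangent_map A F z v) \<le> kobayashi_metric M A z v"
  unfolding kobayashi_metric_def
proof (rule cInf_superset_mono[OF disc_scales_nonempty[OF z v] bdd_below_disc_scales], rule subsetI)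
  fix l assume "l \<in> disc_scales z v"
  then obtain h where l: "l > 0" and h: "h \<in> holomorphic_discs M A" "h 0 = z"
    and h0: "disc_deriv0 A h = (\<lambda>c. v c /\<^sub>R l)" by blast
  have conth: "continuous_map (top_of_set (ball 0 1)) M h"
    using h unfolding holomorphic_discs_def by blast
  have contF: "continuous_map M M F" using F unfolding holomorphic_self_map_def by blast
  have op: "open (coord c ` {z \<in> chart_dom c. F z \<in> chart_dom c'})"
    if "c \<in> A" "c' \<in> A" for c c'
    using open_self_map_chart_domain[OF contF that] .
  have hv: "holomorphic_vec_on (coord c' \<circ> F \<circ> chart_inv c) (coord c ` {z \<in> chart_dom c. F z \<in> chart_dom c'})"
    if "c \<in> A" "c' \<in> A" for c c'
    using F that unfolding holomorphic_self_map_def by blast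
  have main: "((\<lambda>\<zeta>. coord c' (F (h \<zeta>))) has_derivative (\<lambda>x. x *s
       frechet_derivative (coord c' \<circ> F \<circ> chart_inv c) (at (coord c (h \<zeta>)))
         (\<chi> i. deriv (\<lambda>\<zeta>. coord c (h \<zeta>) $ i) \<zeta>))) (at \<zeta>)"
    if "c \<in> A" "c' \<in> A" "\<zeta> \<in> ball 0 1" "h \<zeta> \<in> chart_dom c" "F (h \<zeta>) \<in> chart_dom c'" for c c' \<zeta>
  proof (rule holomorphic_vec_on_chain[OF hv op _ holomorphic_disc_deriv[OF h(1)]])
    show "\<forall>\<^sub>F w in nhds \<zeta>. coord c' (F (h w)) = (coord c' \<circ> F \<circ> chart_inv c) (coord c (h w))"
      using eventually_disc_in[OF conth openin_chart_dom that(3,4), OF that(1)]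
      by eventually_elim (simp add: chart_inv_coord that(1))
  qed (use that in auto)
  have disc: "F \<circ> h \<in> holomorphic_discs M A"
  proof (rule holomorphic_discI)
    show "continuous_map (top_of_set (ball 0 1)) M (F \<circ> h)"
      using continuous_map_compose[OF conth contF] .
    fix c' \<zeta> assume *: "c' \<in> A" "\<zeta> \<in> ball 0 1" "(F \<circ> h) \<zeta> \<in> chart_dom c'"
    have "h \<zeta> \<in> topspace M" using conth *(2) by (auto simp: continuous_map_def)
    then obtain c where "c \<in> A" "h \<zeta> \<in> chart_dom c" using chart_around by blast
    then show "\<exists>d. ((\<lambda>\<zeta>. coord c' ((F \<circ> h) \<zeta>)) has_derivative (\<lambda>x. x *s d)) (at \<zeta>)"
      using main[of c c' \<zeta>] * by auto
  qed
  from tangent_map_in_chart[OF z] obtain c where c: "c \<in> A" "z \<in> chart_dom c"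
    and tm: "\<And>F v c'. tangent_map A F z v c' =
      (if c' \<in> A \<and> F z \<in> chart_dom c'
       then frechet_derivative (coord c' \<circ> F \<circ> chart_inv c) (at (coord c z)) (v c) else 0)"
    by blast
  have "disc_deriv0 A (F \<circ> h) = (\<lambda>c. tangent_map A F z v c /\<^sub>R l)"
  proof (rule disc_deriv0_eqI)
    fix c' assume *: "c' \<in> A" "(F \<circ> h) 0 \<in> chart_dom c'"
    let ?D = "frechet_derivative (coord c' \<circ> F \<circ> chart_inv c) (at (coord c z))"
    have "linear ?D"
      using holomorphic_vec_on_frechet(1)[OF hv op, OF c(1) *(1) c(1) *(1)] c * h(2) has_derivative_linear
      by auto
    moreover have "(\<chi> i. deriv (\<lambda>\<zeta>. coord c (h \<zeta>) $ i) 0) = v c /\<^sub>R l"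
      using fun_cong[OF h0, of c] c h(2) by (simp add: disc_deriv0_def)
    ultimately show "((\<lambda>\<zeta>. coord c' ((F \<circ> h) \<zeta>)) has_derivative
        (\<lambda>x. x *s (tangent_map A F z v c' /\<^sub>R l))) (at 0)"
      using main[of c c' 0] c * h(2)
      by (simp add: tm linear_scale)
  qed (use h(2) in \<open>auto simp: tm\<close>)
  then show "l \<in> disc_scales (F z) (tangent_map A F z v)"
    using disc l h(2) by (intro CollectI conjI bexI[of _ "F \<circ> h"]) simp_all
qed

text \<open>
  This is the Cauchy estimate for the components of the disc in one chart, which are bounded by 1 up
  to an additive constant.
\<close>

lemma norm_disc_deriv0_le:
  assumes h: "h \<in> holomorphic_discs M A" and c: "c \<in> A"
    and \<rho>: "\<rho> > 0" "cball 0 \<rho> \<subseteq> ball (0 :: complex) 1"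
    and sub: "h ` cball 0 \<rho> \<subseteq> {x \<in> chart_dom c. coord c x \<in> ball y 1}"
  shows "norm (disc_deriv0 A h c $ i) \<le> 1 / \<rho>"
proof -
  let ?k = "\<lambda>\<zeta>. coord c (h \<zeta>) $ i"
  have in_U: "h \<zeta> \<in> chart_dom c" "coord c (h \<zeta>) \<in> ball y 1" if "\<zeta> \<in> cball 0 \<rho>" for \<zeta>
    using sub that by blast+
  have "?k holomorphic_on {\<zeta> \<in> ball 0 1. h \<zeta> \<in> chart_dom c}"
    using h c unfolding holomorphic_discs_def by blast
  then have hol: "?k holomorphic_on cball 0 \<rho>"
    by (rule holomorphic_on_subset) (use in_U \<rho>(2) in auto)
  have "norm ((deriv ^^ 1) ?k 0) \<le> fact 1 * 1 / \<rho> ^ 1"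
  proof (rule Cauchy_higher_deriv_bound[where y = "y $ i"])
    show "?k w \<in> ball (y $ i) 1" if "w \<in> ball 0 \<rho>" for w
    proof -
      have "dist (y $ i) (?k w) \<le> dist y (coord c (h w))"
        by (rule dist_vec_nth_le)
      also have "\<dots> < 1" using in_U(2)[of w] that by simp
      finally show ?thesis by simp
    qed
  qed (use hol \<rho>(1) holomorphic_on_imp_continuous_on holomorphic_on_subset[OF hol ball_subset_cball] in auto)
  moreover have "h 0 \<in> chart_dom c" using in_U(1)[of 0] \<rho>(1) by simp
  ultimately show ?thesis using c by (simp add: disc_deriv0_def)
qed

text \<open>
  If \<open>F\<^sub>K (z, v) = 0\<close>, there are discs through \<open>z\<close> with derivative \<open>v / l\<^sub>n\<close> and \<open>l\<^sub>n \<rightarrow> 0\<close>. All of them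
  meet the compact set \<open>{z}\<close>, so tautness gives a convergent subsequence; from some index on it maps
  a fixed disc about 0 into a fixed ball of a chart around \<open>z\<close>, and the Cauchy estimate bounds
  \<open>v / l\<^sub>n\<close>.
\<close>

lemma taut_kobayashi_metric_eq_0:
  assumes taut: "taut M A" and z: "z \<in> topspace M" and v: "v \<in> tangent_space A z"
    and 0: "kobayashi_metric M A z v = 0"
  shows "v = (\<lambda>c. 0)"
proof
  fix c show "v c = 0"
  proof (cases "c \<in> A \<and> z \<in> chart_dom c")
    case False
    then show ?thesis using v unfolding tangent_space_def by blast
  next
    case True
    have "\<exists>l\<in>disc_scales z v. l < 1 / real (Suc n)" for n
      using 0 cInf_lessD[OF disc_scales_nonempty[OF z v], of "1 / real (Suc n)"]
      unfolding kobayashi_metric_def by simp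
    then have "\<forall>n. \<exists>l. l \<in> disc_scales z v \<and> l < 1 / real (Suc n)"
      unfolding Bex_def by (rule allI)
    from choice[OF this] obtain l
      where l0: "\<forall>n. l n \<in> disc_scales z v \<and> l n < 1 / real (Suc n)" ..
    note l = spec[OF l0, THEN conjunct1] spec[OF l0, THEN conjunct2]
    then have "\<forall>n. \<exists>h. h \<in> holomorphic_discs M A \<and> h 0 = z \<and> disc_deriv0 A h = (\<lambda>c. v c /\<^sub>R l n)"
      unfolding Bex_def by blast
    from choice[OF this] obtain h where h: "\<And>n. h n \<in> holomorphic_discs M A" "\<And>n. h n 0 = z"
        "\<And>n. disc_deriv0 A (h n) = (\<lambda>c. v c /\<^sub>R l n)" by fast
    obtain r where r: "strict_mono r"
      and alt: "(\<exists>g\<in>holomorphic_discs M A. locally_uniform_limit M (h \<circ> r) g) \<or>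
         compactly_divergent M (h \<circ> r)"
      using taut h(1) unfolding taut_def by blast
    have "\<not> compactly_divergent M (h \<circ> r)"
    proof
      assume "compactly_divergent M (h \<circ> r)"
      moreover have "compact {0 :: complex}" "{0 :: complex} \<subseteq> ball 0 1" "compactin M {z}"
        using z by simp_all
      ultimately have "\<forall>\<^sub>F n in sequentially. (h \<circ> r) n ` {0} \<inter> {z} = {}"
        unfolding compactly_divergent_def by blast
      then show False by (simp add: h(2))
    qed
    then obtain g where g: "g \<in> holomorphic_discs M A" and lim: "locally_uniform_limit M (h \<circ> r) g"
      using alt by blast
    have contg: "continuous_map (top_of_set (ball 0 1)) M g"
      using g unfolding holomorphic_discs_def by blast
    have g0: "g 0 = z"
    proof (rule ccontr)
      assume "g 0 \<noteq> z"
      moreover have "g 0 \<in> topspace M" using contg by (auto simp: continuous_map_def)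
      ultimately obtain U where U: "openin M U" "g 0 \<in> U" "z \<notin> U"
        using z manifold unfolding complex_manifold_def Hausdorff_space_def disjnt_def by blast
      have "compact {0 :: complex}" "{0 :: complex} \<subseteq> ball 0 1" "g ` {0} \<subseteq> U"
        using U by simp_all
      then have "\<forall>\<^sub>F n in sequentially. (h \<circ> r) n ` {0} \<subseteq> U"
        using lim U(1) unfolding locally_uniform_limit_def by blast
      then show False using U by (simp add: h(2))
    qed
    define U where "U = {x \<in> chart_dom c. coord c x \<in> ball (coord c z) 1}"
    have U: "openin M U" unfolding U_def using openin_coord_preimage True by blast
    have "\<forall>\<^sub>F w in nhds 0. w \<in> ball 0 1 \<and> g w \<in> U"
      using eventually_disc_in[OF contg U, of 0] True g0 by (simp add: U_def)
    then obtain \<rho>' where \<rho>': "\<rho>' > 0" "\<And>w. dist w 0 < \<rho>' \<Longrightarrow> w \<in> ball 0 1 \<and> g w \<in> U"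
      unfolding eventually_nhds_metric by blast
    define \<rho> where "\<rho> = \<rho>' / 2"
    have \<rho>: "\<rho> > 0" "cball (0 :: complex) \<rho> \<subseteq> ball 0 1" "g ` cball 0 \<rho> \<subseteq> U"
    proof -
      have "dist w 0 < \<rho>'" if "w \<in> cball 0 \<rho>" for w
        using that \<rho>'(1) unfolding \<rho>_def mem_cball dist_commute[of 0] by linarith
      then have "w \<in> ball 0 1 \<and> g w \<in> U" if "w \<in> cball 0 \<rho>" for w using \<rho>'(2) that by blast
      then show "cball (0 :: complex) \<rho> \<subseteq> ball 0 1" "g ` cball 0 \<rho> \<subseteq> U" by blast+
    qed (use \<rho>'(1) in \<open>simp add: \<rho>_def\<close>)
    then have "\<forall>\<^sub>F n in sequentially. (h \<circ> r) n ` cball 0 \<rho> \<subseteq> U"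
      using lim U compact_cball unfolding locally_uniform_limit_def by blast
    then obtain N where N: "\<And>n. n \<ge> N \<Longrightarrow> h (r n) ` cball 0 \<rho> \<subseteq> U"
      unfolding eventually_sequentially by auto
    have bound: "norm (v c $ i) \<le> (1 / \<rho>) * (1 / real (Suc n))" if "n \<ge> N" for n i
    proof -
      have "norm (disc_deriv0 A (h (r n)) c $ i) \<le> 1 / \<rho>"
        using N[OF that] True unfolding U_def by (intro norm_disc_deriv0_le[OF h(1)]) (use \<rho> in auto)
      then have "norm (v c $ i) / l (r n) \<le> 1 / \<rho>"
        using l(1)[of "r n"] by (simp add: h(3) divide_inverse mult.commute)
      then have "norm (v c $ i) \<le> (1 / \<rho>) * l (r n)"
        using l(1)[of "r n"] by (simp add: pos_divide_le_eq)
      also have "l (r n) \<le> 1 / real (Suc n)"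
      proof -
        have "real (Suc n) \<le> real (Suc (r n))" using seq_suble[OF r, of n] by simp
        then have "1 / real (Suc (r n)) \<le> 1 / real (Suc n)" by (intro divide_left_mono) auto
        then show ?thesis using l(2)[of "r n"] by linarith
      qed
      then have "(1 / \<rho>) * l (r n) \<le> (1 / \<rho>) * (1 / real (Suc n))"
        using \<rho>(1) by (intro mult_left_mono) auto
      finally show ?thesis .
    qed
    have "norm (v c $ i) \<le> 0" for i
    proof (rule LIMSEQ_le_const)
      show "(\<lambda>n. (1 / \<rho>) * (1 / real (Suc n))) \<longlonglongrightarrow> 0"
        by (rule tendsto_mult_right_zero[OF LIMSEQ_inverse_real_of_nat[unfolded inverse_eq_divide]])
      show "\<exists>N. \<forall>n\<ge>N. norm (v c $ i) \<le> (1 / \<rho>) * (1 / real (Suc n))" using bound by blast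
    qed
    then show ?thesis by (simp add: vec_eq_iff)
  qed
qed

section \<open>Flows\<close>

text \<open>
  The vector field is invariant under its own flow, since \<open>\<phi>\<^sub>t\<close> maps the integral curve through \<open>z\<close>
  to the integral curve through \<open>\<phi>\<^sub>t z\<close>.
\<close>

lemma tangent_map_flow:
  assumes flow: "complete_holomorphic_flow M A f \<phi>" and f: "holomorphic_vector_field M A f"
    and z: "z \<in> topspace M" and t: "t \<ge> 0"
  shows "tangent_map A (\<phi> t) z (f z) = f (\<phi> t z)"
proof
  fix c'
  have F: "holomorphic_self_map M A (\<phi> t)" and \<phi>0: "\<phi> 0 z = z"
    and semi: "\<And>s. s \<ge> 0 \<Longrightarrow> \<phi> (t + s) z = \<phi> t (\<phi> s z)"
    and curve: "integral_curve M A f (\<lambda>t. \<phi> t z)"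
    using flow z t unfolding complete_holomorphic_flow_def by auto
  have contF: "continuous_map M M (\<phi> t)" using F unfolding holomorphic_self_map_def by blast
  have Fz: "\<phi> t z \<in> topspace M" using contF z by (auto simp: continuous_map_def)
  from tangent_map_in_chart[OF z] obtain c where c: "c \<in> A" "z \<in> chart_dom c"
    and tm: "\<And>F v c'. tangent_map A F z v c' =
      (if c' \<in> A \<and> F z \<in> chart_dom c'
       then frechet_derivative (coord c' \<circ> F \<circ> chart_inv c) (at (coord c z)) (v c) else 0)"
    by blast
  show "tangent_map A (\<phi> t) z (f z) c' = f (\<phi> t z) c'"
  proof (cases "c' \<in> A \<and> \<phi> t z \<in> chart_dom c'")
    case False
    then show ?thesis
      using f Fz unfolding holomorphic_vector_field_def tangent_space_def
      by (auto simp: tm)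
  next
    case True
    let ?G = "coord c' \<circ> \<phi> t \<circ> chart_inv c"
    let ?S = "coord c ` {z \<in> chart_dom c. \<phi> t z \<in> chart_dom c'}"
    have hv: "holomorphic_vec_on ?G ?S"
      using F c True unfolding holomorphic_self_map_def by blast
    have op: "open ?S"
      using open_self_map_chart_domain[OF contF c(1)] True by blast
    have G: "(?G has_derivative frechet_derivative ?G (at (coord c z))) (at (coord c z))"
      using holomorphic_vec_on_frechet(1)[OF hv op] c True by blast
    have contc: "continuous_map (top_of_set {0..}) M (\<lambda>s. \<phi> s z)"
      using curve unfolding integral_curve_def by blast
    have D0: "((\<lambda>s. coord c (\<phi> s z)) has_vector_derivative f z c) (at 0 within {0..})"
      using curve c \<phi>0 unfolding integral_curve_def by force
    \<comment> \<open>Both sides are velocities at \<open>s = 0\<close> of the curve \<open>\<phi>\<^sub>t (\<phi>\<^sub>s z) = \<phi>\<^sub>t\<^sub>+\<^sub>s z\<close>: by the chain rule through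
      \<open>\<phi>\<^sub>t\<close>, and as a shift of the integral curve. Times are nonnegative, so the derivatives are
      one-sided.\<close>
    have lhs: "((\<lambda>s. ?G (coord c (\<phi> s z))) has_vector_derivative
        frechet_derivative ?G (at (coord c z)) (f z c)) (at 0 within {0..})"
      using vector_derivative_diff_chain_within[OF D0, of ?G "frechet_derivative ?G (at (coord c z))"]
        G \<phi>0 by (simp add: o_def has_derivative_at_withinI)
    have ev: "\<forall>\<^sub>F s in at 0 within {0..}. coord c' (\<phi> (t + s) z) = ?G (coord c (\<phi> s z))"
    proof -
      have "openin (top_of_set {0..}) {s \<in> {0..}. \<phi> s z \<in> chart_dom c}"
        using openin_continuous_map_preimage[OF contc openin_chart_dom[OF c(1)]] by simp
      then obtain V where V: "open V" "{s \<in> {0..}. \<phi> s z \<in> chart_dom c} = {0..} \<inter> V"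
        unfolding openin_open by blast
      have "0 \<in> {s \<in> {0..}. \<phi> s z \<in> chart_dom c}" using \<phi>0 c by simp
      then have "0 \<in> V" using V by blast
      then have "\<forall>\<^sub>F s in at 0 within {0..}. s \<in> V \<and> s \<in> {0..}"
        using V(1) by (auto simp: eventually_at_topological)
      then show ?thesis
      proof eventually_elim
        case (elim s)
        then have "\<phi> s z \<in> chart_dom c" "s \<ge> 0" using V(2) by auto
        then show ?case using semi chart_inv_coord c by simp
      qed
    qed
    have "((\<lambda>s. coord c' (\<phi> (t + s) z)) has_vector_derivative
        frechet_derivative ?G (at (coord c z)) (f z c)) (at 0 within {0..})"
      using lhs ev semi[of 0] c \<phi>0 chart_inv_coord unfolding has_vector_derivative_def
      by (auto elim!: has_derivative_transform_eventually elim: eventually_mono)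
    moreover have "((\<lambda>s. coord c' (\<phi> (t + s) z)) has_vector_derivative f (\<phi> t z) c') (at 0 within {0..})"
    proof -
      have "((\<lambda>s. coord c' (\<phi> s z)) has_vector_derivative f (\<phi> t z) c') (at t within {0..})"
        using curve True t unfolding integral_curve_def by blast
      then have "((\<lambda>s. coord c' (\<phi> s z)) has_vector_derivative f (\<phi> t z) c')
          (at (t + 0) within (+) t ` {0..})"
        using t by (auto intro: has_vector_derivative_within_subset)
      moreover have "((+) t has_vector_derivative 1) (at 0 within {0..})"
        by (auto intro!: derivative_eq_intros)
      ultimately show ?thesis
        using vector_diff_chain_within[of "(+) t" 1 0 "{0..}"] by (fastforce simp: o_def)
    qed
    ultimately have "frechet_derivative ?G (at (coord c z)) (f z c) = f (\<phi> t z) c'"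
      by (rule vector_derivative_unique_within[rotated]) (simp add: at_within_Ici_at_right)
    then show ?thesis using True by (simp add: tm)
  qed
qed

text \<open>
  The zero derivative in charts makes the curve locally constant, and the half-line is connected.
\<close>

lemma integral_curve_constant:
  assumes curve: "integral_curve M A f \<gamma>" and zero: "\<And>t. t \<ge> 0 \<Longrightarrow> f (\<gamma> t) = (\<lambda>c. 0)"
    and t: "t \<ge> 0"
  shows "\<gamma> t = \<gamma> 0"
proof (rule connected_local_const[where A = "{0..}"])
  show "\<forall>a\<in>{0..}. \<forall>\<^sub>F b in at a within {0..}. \<gamma> a = \<gamma> b"
  proof
    fix a :: real assume a: "a \<in> {0..}"
    have cont: "continuous_map (top_of_set {0..}) M \<gamma>"
      using curve unfolding integral_curve_def by blast
    then have "\<gamma> a \<in> topspace M" using a by (auto simp: continuous_map_def)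
    then obtain c where c: "c \<in> A" "\<gamma> a \<in> chart_dom c" using chart_around by blast
    have "openin (top_of_set {0..}) {s \<in> {0..}. \<gamma> s \<in> chart_dom c}"
      using openin_continuous_map_preimage[OF cont openin_chart_dom[OF c(1)]] by simp
    moreover have "a \<in> {s \<in> {0..}. \<gamma> s \<in> chart_dom c}" using a c by simp
    ultimately obtain e where e: "e > 0" "ball a e \<inter> {0..} \<subseteq> {s \<in> {0..}. \<gamma> s \<in> chart_dom c}"
      unfolding openin_contains_ball by blast
    let ?J = "ball a e \<inter> {0..}"
    have "((\<lambda>s. coord c (\<gamma> s)) has_derivative (\<lambda>h. 0)) (at s within ?J)" if "s \<in> ?J" for s
    proof -
      have "((\<lambda>s. coord c (\<gamma> s)) has_vector_derivative f (\<gamma> s) c) (at s within {0..})"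
        using curve c that e(2) unfolding integral_curve_def by blast
      then have "((\<lambda>s. coord c (\<gamma> s)) has_derivative (\<lambda>h. 0)) (at s within {0..})"
        using zero that by (simp add: has_vector_derivative_def)
      then show ?thesis by (rule has_derivative_subset) auto
    qed
    moreover have "convex ?J" by (intro convex_Int convex_ball convex_real_interval)
    ultimately obtain k where k: "\<And>s. s \<in> ?J \<Longrightarrow> coord c (\<gamma> s) = k"
      using has_derivative_zero_constant[of ?J "\<lambda>s. coord c (\<gamma> s)"] by blast
    have "\<gamma> a = \<gamma> b" if "b \<in> ?J" for b
    proof -
      have "coord c (\<gamma> a) = coord c (\<gamma> b)" using k that a e(1) by simp
      moreover have "\<gamma> b \<in> chart_dom c" using that e(2) by blast
      ultimately show ?thesis using c chart_inv_coord by metis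
    qed
    then show "\<forall>\<^sub>F b in at a within {0..}. \<gamma> a = \<gamma> b"
      unfolding eventually_at using e(1) by (intro exI[of _ e]) (auto simp: dist_commute)
  qed
qed (use t in auto)

end

section \<open>Periodic trajectories\<close>

lemma antimono_periodic_imp_constant:
  fixes \<psi> :: "real \<Rightarrow> real"
  assumes anti: "\<And>s t. 0 \<le> s \<Longrightarrow> s \<le> t \<Longrightarrow> \<psi> t \<le> \<psi> s"
    and "T > 0" and per: "\<And>t. t \<ge> 0 \<Longrightarrow> \<psi> (t + T) = \<psi> t" and t: "t \<ge> 0"
  shows "\<psi> t = \<psi> 0"
proof (rule antisym)
  show "\<psi> t \<le> \<psi> 0" using anti t by simp
  obtain n :: nat where n: "t < real n * T" using \<open>T > 0\<close> reals_Archimedean3 by blast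
  have "\<psi> (real n * T) = \<psi> 0" for n :: nat
  proof (induction n)
    case (Suc n)
    then show ?case using per[of "real n * T"] \<open>T > 0\<close> by (simp add: algebra_simps)
  qed simp
  then show "\<psi> 0 \<le> \<psi> t" using anti[of t "real n * T"] n t by simp
qed

lemma upper_dini_deriv_constant:
  assumes "\<And>t. t \<ge> 0 \<Longrightarrow> \<psi> t = \<psi> 0"
  shows "upper_dini_deriv \<psi> 0 = 0"
proof -
  have "\<forall>\<^sub>F \<epsilon> in at_right 0. ereal ((\<psi> (0 + \<epsilon>) - \<psi> 0) / \<epsilon>) = 0"
    using eventually_at_right_less[of "0 :: real"]
  proof eventually_elim
    case (elim \<epsilon>)
    then show ?case using assms[of \<epsilon>] by (simp add: zero_ereal_def)
  qed
  then have "upper_dini_deriv \<psi> 0 = Limsup (at_right 0) (\<lambda>\<epsilon>::real. 0)"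
    unfolding upper_dini_deriv_def by (rule Limsup_eq)
  then show ?thesis by (simp add: Limsup_const)
qed

theorem theorem5:
  fixes M :: "'a topology"
    and A :: "('a, 'n::finite) chart set"
    and f :: "'a \<Rightarrow> ('a, 'n) tangent_vector"
    and \<phi> :: "real \<Rightarrow> 'a \<Rightarrow> 'a"
    and \<Omega> :: "'a set"
    and rate T :: real
    and z :: "real \<Rightarrow> 'a"
  assumes "complex_manifold M A"
    and "kobayashi_hyperbolic M A"
    and "taut M A"
    and "holomorphic_vector_field M A f"
    and "complete_holomorphic_flow M A f \<phi>"
    and "\<Omega> \<subseteq> topspace M"
    and "forward_invariant \<phi> \<Omega>"
    and "rate > 0"
    and "intrinsically_contracting M A \<phi> rate \<Omega>"
    and "\<And>t. t \<ge> 0 \<Longrightarrow> z t = \<phi> t (z 0)"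
    and "\<And>t. t \<ge> 0 \<Longrightarrow> z t \<in> \<Omega>"
    and "T > 0"
    and "\<And>t. t \<ge> 0 \<Longrightarrow> z (t + T) = z t"
  shows "\<exists>p\<in>\<Omega>. f p = (\<lambda>c. 0) \<and> (\<forall>t\<ge>0. z t = p)"
proof -
  note man = assms(1) and taut = assms(3) and f = assms(4) and flow = assms(5)
    and traj = assms(10) and in\<Omega> = assms(11) and per = assms(13)
  have zM: "z t \<in> topspace M" if "t \<ge> 0" for t using in\<Omega>[OF that] assms(6) by blast
  have fz: "f (z t) \<in> tangent_space A (z t)" if "t \<ge> 0" for t
    using f zM[OF that] unfolding holomorphic_vector_field_def by blast
  have semi: "\<phi> s (z t) = z (s + t)" if "s \<ge> 0" "t \<ge> 0" for s t
    using flow zM[of 0] traj[of t] traj[of "s + t"] that unfolding complete_holomorphic_flow_def by simp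
  have tan: "tangent_map A (\<phi> s) (z t) (f (z t)) = f (z (s + t))" if "s \<ge> 0" "t \<ge> 0" for s t
    using tangent_map_flow[OF man flow f zM[OF that(2)] that(1)] semi[OF that] by simp
  define \<psi> where "\<psi> t = kobayashi_metric M A (z t) (f (z t))" for t
  have anti: "\<psi> t \<le> \<psi> s" if "0 \<le> s" "s \<le> t" for s t
  proof -
    have "holomorphic_self_map M A (\<phi> (t - s))"
      using flow that unfolding complete_holomorphic_flow_def by simp
    from kobayashi_metric_tangent_map_le[OF man this zM fz, OF that(1) that(1)]
    show ?thesis using that by (simp add: \<psi>_def tan semi)
  qed
  have const: "\<psi> t = \<psi> 0" if "t \<ge> 0" for t
    by (rule antimono_periodic_imp_constant[OF anti \<open>T > 0\<close> _ that]) (simp_all add: \<psi>_def per)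
  have "\<psi> 0 = 0"
  proof (rule antisym)
    \<comment> \<open>the function in the contraction hypothesis, known to agree with \<open>\<psi>\<close> only for nonnegative times\<close>
    define \<psi>' where "\<psi>' t = kobayashi_metric M A (\<phi> t (z 0)) (tangent_map A (\<phi> t) (z 0) (f (z 0)))" for t
    have eq: "\<psi>' t = \<psi> t" if "t \<ge> 0" for t
      unfolding \<psi>'_def \<psi>_def using tan[OF that, of 0] semi[OF that, of 0] by simp
    have "upper_dini_deriv \<psi>' 0 \<le> ereal (- rate * \<psi>' 0)"
      using assms(9) in\<Omega>[of 0] fz[of 0] unfolding intrinsically_contracting_def Let_def \<psi>'_def by simp
    moreover have "upper_dini_deriv \<psi>' 0 = 0"
      by (rule upper_dini_deriv_constant) (metis eq const order_refl)
    ultimately have "rate * \<psi> 0 \<le> 0" by (simp add: eq zero_ereal_def)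
    then show "\<psi> 0 \<le> 0" using \<open>rate > 0\<close> by (simp add: mult_le_0_iff)
    show "0 \<le> \<psi> 0"
      unfolding \<psi>_def using kobayashi_metric_nonneg[OF man zM fz] by simp
  qed
  then have zero: "f (z t) = (\<lambda>c. 0)" if "t \<ge> 0" for t
    using taut_kobayashi_metric_eq_0[OF man taut zM fz, OF that that] const[OF that] by (simp add: \<psi>_def)
  have "integral_curve M A f (\<lambda>t. \<phi> t (z 0))"
    using flow zM[of 0] unfolding complete_holomorphic_flow_def by simp
  then have "\<phi> t (z 0) = \<phi> 0 (z 0)" if "t \<ge> 0" for t
    using integral_curve_constant[OF man _ _ that, of f "\<lambda>t. \<phi> t (z 0)"] zero traj by metis
  then have "\<forall>t\<ge>0. z t = z 0" using traj by (metis order_refl)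
  moreover have "f (z 0) = (\<lambda>c. 0)" "z 0 \<in> \<Omega>" using zero[of 0] in\<Omega>[of 0] by simp_all
  ultimately show ?thesis by blast
qed

end
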